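(* For all integers $0\le m<n$, $$d_{\mathrm{GH}}^{\mathbb Z_2}(\square^m_\infty,\square^n_\infty)=1.$$
   Context: $\square^n:=\partial([-1,1]^{n+1})=\{(x_0,\dots,x_n)\in[-1,1]^{n+1}:x_i=\pm1\text{ for some }i\}$, and $\square^n_\infty$ is $\square^n$ with the metric induced by the $\ell^\infty$-norm of $\mathbb R^{n+1}$ and the $\mathbb Z_2$-action $u\mapsto-u$. For metric spaces $X,Y$ with isometric $\mathbb Z_2$-actions generated by involutions $\tau_X,\tau_Y$, $d_{\mathrm{GH}}^{\mathbb Z_2}(X,Y):=\frac12\inf_R\sup_{(x,y),(x',y')\in R}|d_X(x,x')-d_Y(y,y')|$, the infimum over all sets $R\subseteq X\times Y$ projecting onto $X$ and onto $Y$ such that $(\tau_X(x),\tau_Y(y))\in R$ whenever $(x,y)\in R$. *)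

theory Defs
  imports "HOL-Analysis.Analysis"
begin

text \<open>
  Points of \<open>\<real>\<^sup>n\<^sup>+\<^sup>1\<close> are functions \<open>x :: nat \<Rightarrow> real\<close> with coordinates \<open>x 0, \<dots>, x n\<close> that
  vanish at all indices above \<open>n\<close>. Negation and subtraction of functions are pointwise and
  preserve this convention.
\<close>

definition cube_boundary :: "nat \<Rightarrow> (nat \<Rightarrow> real) set" where
  "cube_boundary n =
     {x. (\<forall>i\<le>n. x i \<in> {-1..1}) \<and> (\<exists>i\<le>n. x i = 1 \<or> x i = -1) \<and> (\<forall>i>n. x i = 0)}"

definition linf_norm :: "nat \<Rightarrow> (nat \<Rightarrow> real) \<Rightarrow> real" where
  "linf_norm n x = Max ((\<lambda>i. \<bar>x i\<bar>) ` {..n})"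

definition cube_inf :: "nat \<Rightarrow> (nat \<Rightarrow> real) metric" where
  "cube_inf n = metric (cube_boundary n, \<lambda>x y. linf_norm n (x - y))"

definition isometric_involution :: "'a metric \<Rightarrow> ('a \<Rightarrow> 'a) \<Rightarrow> bool" where
  "isometric_involution X \<tau> \<longleftrightarrow>
     (\<forall>x\<in>mspace X. \<tau> x \<in> mspace X \<and> \<tau> (\<tau> x) = x) \<and>
     (\<forall>x\<in>mspace X. \<forall>y\<in>mspace X. mdist X (\<tau> x) (\<tau> y) = mdist X x y)"

definition Z2_correspondence ::
    "'a metric \<Rightarrow> ('a \<Rightarrow> 'a) \<Rightarrow> 'b metric \<Rightarrow> ('b \<Rightarrow> 'b) \<Rightarrow> ('a \<times> 'b) set \<Rightarrow> bool" where
  "Z2_correspondence X \<tau>\<^sub>X Y \<tau>\<^sub>Y R \<longleftrightarrow>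
     R \<subseteq> mspace X \<times> mspace Y \<and> fst ` R = mspace X \<and> snd ` R = mspace Y \<and>
     (\<forall>x y. (x, y) \<in> R \<longrightarrow> (\<tau>\<^sub>X x, \<tau>\<^sub>Y y) \<in> R)"

text \<open>
  The values lie in \<open>[0, \<infinity>]\<close>, so that infima and suprema have their usual meaning also for
  unbounded spaces.
\<close>

definition distortion :: "'a metric \<Rightarrow> 'b metric \<Rightarrow> ('a \<times> 'b) set \<Rightarrow> ennreal" where
  "distortion X Y R =
     (SUP ((x, y), (x', y')) \<in> R \<times> R. ennreal \<bar>mdist X x x' - mdist Y y y'\<bar>)"

text \<open>Meaningful when \<open>\<tau>\<^sub>X\<close> and \<open>\<tau>\<^sub>Y\<close> are isometric involutions of \<open>X\<close> and \<open>Y\<close>.\<close>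

definition dGH_Z2 ::
    "'a metric \<Rightarrow> ('a \<Rightarrow> 'a) \<Rightarrow> 'b metric \<Rightarrow> ('b \<Rightarrow> 'b) \<Rightarrow> ennreal" where
  "dGH_Z2 X \<tau>\<^sub>X Y \<tau>\<^sub>Y = (INF R \<in> {R. Z2_correspondence X \<tau>\<^sub>X Y \<tau>\<^sub>Y R}. distortion X Y R) / 2"

lemma linf_norm_le_iff: "linf_norm n x \<le> c \<longleftrightarrow> (\<forall>i\<le>n. \<bar>x i\<bar> \<le> c)"
  unfolding linf_norm_def by (subst Max_le_iff) auto

lemma abs_le_linf_norm: "i \<le> n \<Longrightarrow> \<bar>x i\<bar> \<le> linf_norm n x"
  using linf_norm_le_iff[of n x "linf_norm n x"] by blast

lemma linf_norm_nonneg: "0 \<le> linf_norm n x"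
  using abs_le_linf_norm[of 0 n x] by linarith

lemma linf_norm_minus: "linf_norm n (- x) = linf_norm n x"
  by (simp add: linf_norm_def)

lemma Metric_space_cube: "Metric_space (cube_boundary n) (\<lambda>x y. linf_norm n (x - y))"
proof
  fix x y z :: "nat \<Rightarrow> real"
  show "0 \<le> linf_norm n (x - y)" by (rule linf_norm_nonneg)
  show "linf_norm n (x - y) = linf_norm n (y - x)"
    by (simp add: linf_norm_def abs_minus_commute)
  show "linf_norm n (x - y) = 0 \<longleftrightarrow> x = y"
    if "x \<in> cube_boundary n" "y \<in> cube_boundary n"
  proof
    assume 0: "linf_norm n (x - y) = 0"
    show "x = y"
    proof
      fix i
      show "x i = y i"
        using abs_le_linf_norm[of i n "x - y"] 0 that
        by (cases "i \<le> n") (auto simp: cube_boundary_def)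
    qed
  next
    assume "x = y"
    then have "linf_norm n (x - y) \<le> 0" by (simp add: linf_norm_le_iff)
    then show "linf_norm n (x - y) = 0" using linf_norm_nonneg[of n "x - y"] by linarith
  qed
  show "linf_norm n (x - z) \<le> linf_norm n (x - y) + linf_norm n (y - z)"
    unfolding linf_norm_le_iff
  proof (intro allI impI)
    fix i assume "i \<le> n"
    then show "\<bar>(x - z) i\<bar> \<le> linf_norm n (x - y) + linf_norm n (y - z)"
      using abs_le_linf_norm[of i n "x - y"] abs_le_linf_norm[of i n "y - z"] by simp
  qed
qed

lemma mspace_cube_inf [simp]: "mspace (cube_inf n) = cube_boundary n"
  by (simp add: cube_inf_def Metric_space.mspace_metric[OF Metric_space_cube])

lemma mdist_cube_inf [simp]: "mdist (cube_inf n) = (\<lambda>x y. linf_norm n (x - y))"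
  by (simp add: cube_inf_def Metric_space.mdist_metric[OF Metric_space_cube])

lemma isometric_involution_cube: "isometric_involution (cube_inf n) uminus"
  unfolding isometric_involution_def
proof (intro conjI ballI)
  fix x assume "x \<in> mspace (cube_inf n)"
  then obtain k where "k \<le> n" "x k = 1 \<or> x k = -1"
    and "\<forall>i\<le>n. -1 \<le> x i \<and> x i \<le> 1" "\<forall>i>n. x i = 0"
    by (auto simp: cube_boundary_def)
  moreover from this have "- x k = 1 \<or> - x k = -1" by auto
  ultimately show "- x \<in> mspace (cube_inf n)"
    by (auto simp: cube_boundary_def intro!: exI[of _ k])
  show "- (- x) = x" by (simp add: fun_eq_iff)
next
  fix x y :: "nat \<Rightarrow> real"
  have "- x - - y = - (x - y)" by (simp add: fun_eq_iff)
  then show "mdist (cube_inf n) (- x) (- y) = mdist (cube_inf n) x y"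
    by (simp add: linf_norm_minus del: minus_diff_eq)
qed

end

theory Submission
  imports Defs "HOL-Library.Z2"
begin

text \<open>
  The upper bound costs nothing: both cubes have diameter at most \<open>2\<close>, so the full product
  \<open>cube_boundary m \<times> cube_boundary n\<close> is a correspondence of distortion at most \<open>2\<close>.

  For the lower bound, a correspondence contains the graph of an odd, not necessarily continuous,
  map \<open>f\<close> from the larger cube boundary to the smaller one (\<open>odd_selection\<close>). Label \<open>y\<close> by
  \<open>\<plusminus>(i + 1)\<close> if \<open>f y\<close> lies on the face where coordinate \<open>i\<close> equals \<open>\<plusminus>1\<close>. This is an odd labelling
  with labels in \<open>{\<plusminus>1, \<dots>, \<plusminus>(m + 1)}\<close>, hence in \<open>{\<plusminus>1, \<dots>, \<plusminus>n}\<close>, so Tucker's lemma yields two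
  points \<open>x\<close>, \<open>y\<close> at distance at most \<open>\<delta>\<close> with opposite labels. Their images lie on opposite faces,
  at distance \<open>2\<close>, and the distortion is at least \<open>2 - \<delta>\<close>; here \<open>\<delta> > 0\<close> is arbitrary.

  Tucker's lemma (\<open>Tucker_cube\<close>) is proved by Ky Fan's counting argument, but with chains modulo
  two made of ordered simplices of small diameter in place of a triangulation. Suppose that no
  two points at distance at most \<open>\<delta>\<close> have opposite labels. Let \<open>fan p\<close> be the cochain that is
  \<open>1\<close> on those simplices whose labels, sorted by absolute value, alternate in sign, the sign of
  the first label being positive iff \<open>p\<close>. Then
  \<open>coboundary (fan True) = fan True + fan False\<close>, and the antipodal map exchanges the two summands
  (\<open>coboundary_fan\<close>, \<open>fan_uminus\<close>). In each dimension \<open>k\<close> there is a symmetric cycle \<open>z\<^sub>k\<close> of small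
  simplices: \<open>z\<^sub>0\<close> is a pair of antipodal points, and \<open>z\<^sub>k\<^sub>+\<^sub>1\<close> is \<open>c\<close> plus its antipode for
  some \<open>c\<close> with boundary \<open>z\<^sub>k\<close>. Evaluating gives
  \<open>z\<^sub>k\<^sub>+\<^sub>1 (fan True) = c (fan True + fan False) = c (coboundary (fan True)) = z\<^sub>k (fan True)\<close>,
  so all these values equal \<open>z\<^sub>0 (fan True) = 1\<close> (\<open>Fan_cycle\<close>). But alternating labels have
  distinct absolute values, so \<open>fan True\<close> vanishes on the \<open>n + 1\<close> vertices of an \<open>n\<close>-simplex
  when only \<open>n\<close> absolute values are available.
\<close>

text \<open>
  By default the simplifier turns the addition and multiplication of \<^typ>\<open>bit\<close> into the bitwise
  operations; the computations below need the ring structure.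
\<close>

declare add_bit_eq_xor [simp del] mult_bit_eq_and [simp del]

lemma bit_add_self [simp]: "(x::bit) + x = 0"
  by (cases x) simp_all

lemma bit_add_left_self [simp]: "(x::bit) + (x + y) = y"
  by (simp flip: add.assoc)

section \<open>Cochains modulo two on ordered simplices\<close>

text \<open>
  A simplex is the list of its vertices. The first summand deletes the leading vertex and the second
  one deletes a later vertex, so this is the usual sum over all facets. The empty list counts as the
  simplex of dimension \<open>-1\<close>, that is, the complex is augmented; this removes all special cases in
  dimension \<open>0\<close>.
\<close>

primrec coboundary :: "('a list \<Rightarrow> bit) \<Rightarrow> 'a list \<Rightarrow> bit" where
  "coboundary \<phi> [] = 0"
| "coboundary \<phi> (x # xs) = \<phi> xs + coboundary (\<lambda>\<sigma>. \<phi> (x # \<sigma>)) xs"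

lemma coboundary_add:
  "coboundary (\<lambda>\<sigma>. \<phi> \<sigma> + \<psi> \<sigma>) xs = coboundary \<phi> xs + coboundary \<psi> xs"
  by (induction xs arbitrary: \<phi> \<psi>) (simp_all add: ac_simps)

lemma coboundary_scale: "coboundary (\<lambda>\<sigma>. c * \<phi> \<sigma>) xs = c * coboundary \<phi> xs"
  by (induction xs arbitrary: \<phi>) (simp_all add: distrib_left)

lemma coboundary_zero [simp]: "coboundary (\<lambda>\<sigma>. 0) xs = 0"
  by (induction xs) simp_all

lemma coboundary_map: "coboundary \<phi> (map f xs) = coboundary (\<lambda>\<sigma>. \<phi> (map f \<sigma>)) xs"
  by (induction xs arbitrary: \<phi>) simp_all

text \<open>
  Only the facets of \<open>xs\<close> matter, and a facet of a sorted simplex is again sorted. The relation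
  \<open>R\<close> keeps track of the latter.
\<close>

lemma coboundary_cong:
  assumes "\<And>\<sigma>. set \<sigma> \<subseteq> set xs \<Longrightarrow> sorted_wrt R \<sigma> \<Longrightarrow> \<phi> \<sigma> = \<psi> \<sigma>" "sorted_wrt R xs"
  shows "coboundary \<phi> xs = coboundary \<psi> xs"
  using assms
proof (induction xs arbitrary: \<phi> \<psi>)
  case (Cons x xs)
  have "coboundary (\<lambda>\<sigma>. \<phi> (x # \<sigma>)) xs = coboundary (\<lambda>\<sigma>. \<psi> (x # \<sigma>)) xs"
  proof (rule Cons.IH)
    fix \<sigma> assume "set \<sigma> \<subseteq> set xs" "sorted_wrt R \<sigma>"
    with Cons.prems(2) show "\<phi> (x # \<sigma>) = \<psi> (x # \<sigma>)"
      by (intro Cons.prems(1)) auto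
  qed (use Cons.prems in auto)
  moreover have "\<phi> xs = \<psi> xs"
    using Cons.prems by auto
  ultimately show ?case by simp
qed simp

lemma coboundary_mset:
  "coboundary (\<lambda>\<sigma>. \<psi> (mset \<sigma>)) xs = (\<Sum>x\<in>#mset xs. \<psi> (mset xs - {#x#}))"
proof (induction xs arbitrary: \<psi>)
  case (Cons x xs)
  have "(\<Sum>y\<in>#mset xs. \<psi> (add_mset x (mset xs - {#y#})))
      = (\<Sum>y\<in>#mset xs. \<psi> (add_mset x (mset xs) - {#y#}))"
    by (rule arg_cong[where f = sum_mset], rule image_mset_cong) auto
  then show ?case
    using Cons.IH[of "\<lambda>M. \<psi> (add_mset x M)"] by simp
qed simp

text \<open>
  The coboundary of a symmetric cochain is symmetric, because it can be written as a sum over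
  the multiset of vertices.
\<close>

lemma coboundary_permute:
  assumes "\<And>\<sigma> \<tau>. mset \<sigma> = mset \<tau> \<Longrightarrow> \<phi> \<sigma> = \<phi> \<tau>" "mset xs = mset ys"
  shows "coboundary \<phi> xs = coboundary \<phi> ys"
proof -
  define \<psi> where "\<psi> M = \<phi> (SOME \<sigma>. mset \<sigma> = M)" for M
  have "\<phi> = (\<lambda>\<sigma>. \<psi> (mset \<sigma>))"
  proof
    fix \<sigma> show "\<phi> \<sigma> = \<psi> (mset \<sigma>)"
      unfolding \<psi>_def by (rule assms(1), rule sym, rule someI[where x = \<sigma>]) simp
  qed
  then show ?thesis
    by (simp add: coboundary_mset assms(2))
qed

section \<open>Fan's alternating cochains\<close>

primrec alternating :: "bool \<Rightarrow> int list \<Rightarrow> bit" where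
  "alternating p [] = 1"
| "alternating p (x # xs) = of_bool ((0 < x) = p) * alternating (\<not> p) xs"

text \<open>
  With \<open>s\<close> the cochain that indicates positive labels, \<open>alternating True\<close> is the cup product of \<open>s\<close>
  with copies of its coboundary, and the right-hand side is the cup product of copies of
  the coboundary of \<open>s\<close> alone. The formula is then the Leibniz rule.
\<close>

lemma coboundary_alternating:
  "coboundary (alternating p) xs = alternating True xs + alternating False xs"
proof (induction xs arbitrary: p)
  case (Cons x xs)
  show ?case
    by (cases p; cases "0 < x") (simp_all add: coboundary_scale Cons.IH ac_simps)
qed simp

lemma alternating_uminus:
  "0 \<notin> set xs \<Longrightarrow> alternating p (map uminus xs) = alternating (\<not> p) xs"
proof (induction xs arbitrary: p)
  case (Cons x xs)
  then show ?case by (cases p; cases "0 < x") auto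
qed simp

lemma distinct_if_alternating:
  assumes "sorted (map abs xs)" "inj_on abs (set xs)" "alternating p xs = 1"
  shows "distinct xs"
  using assms
proof (induction xs arbitrary: p)
  case (Cons x xs)
  have sgn: "(0 < x) = p" and alt: "alternating (\<not> p) xs = 1"
    using Cons.prems(3) by (auto simp: of_bool_def split: if_splits)
  have "x \<notin> set xs"
  proof
    assume x: "x \<in> set xs"
    then obtain y ys where xs: "xs = y # ys" by (cases xs) auto
    have "\<bar>x\<bar> = \<bar>y\<bar>"
      using Cons.prems(1) x xs by fastforce
    then have "x = y"
      using Cons.prems(2) xs by (auto dest: inj_onD)
    with sgn alt xs show False
      by (auto simp: of_bool_def split: if_splits)
  qed
  moreover have "distinct xs"
    using Cons.IH[OF _ _ alt] Cons.prems by auto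
  ultimately show ?case by simp
qed simp

text \<open>
  The first case is the interesting one; there no label occurs together with its negative, so sorting
  by absolute value has a result that depends only on the multiset of labels. The default value
  \<open>0\<close> makes the cochain symmetric on all simplices.
\<close>

definition fan :: "bool \<Rightarrow> int list \<Rightarrow> bit" where
  "fan p xs = (if inj_on abs (set xs) then alternating p (sort_key abs xs) else 0)"

lemma fan_permute:
  assumes "mset xs = mset ys"
  shows "fan p xs = fan p ys"
proof -
  have "set xs = set ys"
    using assms by (metis set_mset_mset)
  moreover have "sort_key abs xs = sort_key abs ys" if "inj_on abs (set xs)"
    by (rule sort_key_inj_key_eq) (use assms that in auto)
  ultimately show ?thesis
    by (simp add: fan_def)
qed

lemma sort_key_abs_uminus:
  "sort_key abs (map uminus xs) = map uminus (sort_key abs (xs :: int list))"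
proof -
  have "insort_key abs (- x) (map uminus ys) = map uminus (insort_key abs x ys)"
    for x :: int and ys
    by (induction ys) auto
  then show ?thesis
    by (induction xs) auto
qed

lemma fan_uminus:
  assumes "0 \<notin> set xs"
  shows "fan p (map uminus xs) = fan (\<not> p) xs"
proof -
  have "inj_on abs (uminus ` set xs) \<longleftrightarrow> inj_on abs (set xs)"
    unfolding inj_on_def by auto
  then show ?thesis
    using assms by (simp add: fan_def sort_key_abs_uminus alternating_uminus)
qed

text \<open>
  By symmetry the simplex may be taken to be sorted, and then so are its facets. On sorted simplices
  \<open>fan\<close> and \<open>alternating\<close> agree. Repeated labels do no harm, since equal neighbours make
  \<open>alternating\<close> vanish.
\<close>

lemma coboundary_fan:
  assumes "inj_on abs (set xs)"
  shows "coboundary (fan p) xs = fan True xs + fan False xs"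
proof -
  let ?ys = "sort_key abs xs"
  have "coboundary (fan p) xs = coboundary (fan p) ?ys"
    by (rule coboundary_permute[OF fan_permute]) simp_all
  also have "\<dots> = coboundary (alternating p) ?ys"
  proof (rule coboundary_cong[where R = "\<lambda>x y. \<bar>x\<bar> \<le> \<bar>y\<bar>"])
    fix \<sigma>
    assume "set \<sigma> \<subseteq> set ?ys" "sorted_wrt (\<lambda>x y. \<bar>x\<bar> \<le> \<bar>y\<bar>) \<sigma>"
    moreover from this have "inj_on abs (set \<sigma>)"
      using inj_on_subset[OF assms, of "set \<sigma>"] by simp
    moreover have "sort_key abs \<sigma> = \<sigma>"
      by (rule sort_key_id_if_sorted) (use calculation in \<open>simp add: sorted_map\<close>)
    ultimately show "fan p \<sigma> = alternating p \<sigma>"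
      by (simp add: fan_def)
  next
    show "sorted_wrt (\<lambda>x y. \<bar>x\<bar> \<le> \<bar>y\<bar>) ?ys"
      using sorted_sort_key[of abs xs] by (simp add: sorted_map)
  qed
  finally show ?thesis
    using assms by (simp add: coboundary_alternating fan_def)
qed

text \<open>
  Alternation excludes repeated labels, and injectivity of the absolute value then makes the
  absolute values distinct: too many for the range \<open>{1..n}\<close>.
\<close>

lemma fan_eq_0:
  assumes "\<And>x. x \<in> set xs \<Longrightarrow> x \<noteq> 0 \<and> \<bar>x\<bar> \<le> int n" "n < length xs"
  shows "fan p xs = 0"
proof (rule ccontr)
  let ?ys = "sort_key abs xs"
  assume "fan p xs \<noteq> 0"
  then have inj: "inj_on abs (set xs)" and alt: "alternating p ?ys = 1"
    by (auto simp: fan_def split: if_splits)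
  have "distinct ?ys"
    by (rule distinct_if_alternating[OF _ _ alt]) (use inj in auto)
  then have "card (abs ` set xs) = length xs"
    using inj by (simp add: card_image distinct_card)
  moreover have "abs ` set xs \<subseteq> {1..int n}"
    using assms(1) by force
  then have "card (abs ` set xs) \<le> n"
    using card_mono[of "{1..int n}" "abs ` set xs"] by simp
  ultimately show False
    using assms(2) by simp
qed

section \<open>Chains as functionals and the prism operator\<close>

text \<open>
  A finite chain modulo two acts on cochains by evaluation, and only this action is used. So a chain is
  taken to be an additive functional that depends only on the values of a cochain on the simplices
  in \<open>T\<close>, and its boundary is the composition with \<^const>\<open>coboundary\<close>.
\<close>

definition chain_on :: "'a list set \<Rightarrow> (('a list \<Rightarrow> bit) \<Rightarrow> bit) \<Rightarrow> bool" where
  "chain_on T c \<longleftrightarrow>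
     (\<forall>\<phi> \<psi>. c (\<lambda>\<sigma>. \<phi> \<sigma> + \<psi> \<sigma>) = c \<phi> + c \<psi>) \<and>
     (\<forall>\<phi> \<psi>. (\<forall>\<sigma>\<in>T. \<phi> \<sigma> = \<psi> \<sigma>) \<longrightarrow> c \<phi> = c \<psi>)"

lemma chain_on_add: "chain_on T c \<Longrightarrow> c (\<lambda>\<sigma>. \<phi> \<sigma> + \<psi> \<sigma>) = c \<phi> + c \<psi>"
  by (simp add: chain_on_def)

lemma chain_on_cong: "chain_on T c \<Longrightarrow> (\<And>\<sigma>. \<sigma> \<in> T \<Longrightarrow> \<phi> \<sigma> = \<psi> \<sigma>) \<Longrightarrow> c \<phi> = c \<psi>"
  by (simp add: chain_on_def)

lemma chain_on_sum:
  assumes "chain_on T c" "chain_on T d"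
  shows "chain_on T (\<lambda>\<phi>. c \<phi> + d \<phi>)"
  unfolding chain_on_def
proof (intro conjI allI impI)
  fix \<phi> \<psi>
  show "c (\<lambda>\<sigma>. \<phi> \<sigma> + \<psi> \<sigma>) + d (\<lambda>\<sigma>. \<phi> \<sigma> + \<psi> \<sigma>) = c \<phi> + d \<phi> + (c \<psi> + d \<psi>)"
    by (simp only: assms[THEN chain_on_add] ac_simps)
  assume eq: "\<forall>\<sigma>\<in>T. \<phi> \<sigma> = \<psi> \<sigma>"
  then have "c \<phi> = c \<psi>" "d \<phi> = d \<psi>"
    by (auto intro: assms[THEN chain_on_cong])
  then show "c \<phi> + d \<phi> = c \<psi> + d \<psi>" by simp
qed

lemma chain_on_pushforward:
  assumes "chain_on T c" "\<And>\<sigma>. \<sigma> \<in> T \<Longrightarrow> map f \<sigma> \<in> T'"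
  shows "chain_on T' (\<lambda>\<phi>. c (\<lambda>\<sigma>. \<phi> (map f \<sigma>)))"
  unfolding chain_on_def
  by (auto simp: chain_on_add[OF assms(1)] intro!: chain_on_cong[OF assms(1)] assms(2))

definition bounds_on :: "'a list set \<Rightarrow> (('a list \<Rightarrow> bit) \<Rightarrow> bit) \<Rightarrow> bool" where
  "bounds_on T z \<longleftrightarrow> (\<exists>c. chain_on T c \<and> (\<forall>\<phi>. c (coboundary \<phi>) = z \<phi>))"

lemma bounds_on_sum:
  assumes "bounds_on T z" "bounds_on T w"
  shows "bounds_on T (\<lambda>\<phi>. z \<phi> + w \<phi>)"
proof -
  obtain c d where "chain_on T c" "\<forall>\<phi>. c (coboundary \<phi>) = z \<phi>"
    and "chain_on T d" "\<forall>\<phi>. d (coboundary \<phi>) = w \<phi>"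
    using assms unfolding bounds_on_def by auto
  then show ?thesis
    unfolding bounds_on_def by (intro exI[of _ "\<lambda>\<phi>. c \<phi> + d \<phi>"]) (simp add: chain_on_sum)
qed

text \<open>
  The dual of the prism operator for two vertex maps: the sum of \<open>\<phi>\<close> over the simplices
  \<open>f x\<^sub>0, \<dots>, f x\<^sub>i, g x\<^sub>i, \<dots>, g x\<^sub>k\<close>.
\<close>

primrec prism :: "('a \<Rightarrow> 'b) \<Rightarrow> ('a \<Rightarrow> 'b) \<Rightarrow> ('b list \<Rightarrow> bit) \<Rightarrow> 'a list \<Rightarrow> bit" where
  "prism f g \<phi> [] = 0"
| "prism f g \<phi> (x # xs) = \<phi> (f x # g x # map g xs) + prism f g (\<lambda>\<sigma>. \<phi> (f x # \<sigma>)) xs"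

lemma prism_add:
  "prism f g (\<lambda>\<sigma>. \<phi> \<sigma> + \<psi> \<sigma>) xs = prism f g \<phi> xs + prism f g \<psi> xs"
  by (induction xs arbitrary: \<phi> \<psi>) (simp_all add: ac_simps)

lemma prism_cong:
  assumes "\<And>\<sigma>. set \<sigma> \<subseteq> f ` set xs \<union> g ` set xs \<Longrightarrow> length \<sigma> = Suc (length xs) \<Longrightarrow> \<phi> \<sigma> = \<psi> \<sigma>"
  shows "prism f g \<phi> xs = prism f g \<psi> xs"
  using assms
proof (induction xs arbitrary: \<phi> \<psi>)
  case (Cons x xs)
  have "prism f g (\<lambda>\<sigma>. \<phi> (f x # \<sigma>)) xs = prism f g (\<lambda>\<sigma>. \<psi> (f x # \<sigma>)) xs"
    by (rule Cons.IH, rule Cons.prems) auto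
  moreover have "\<phi> (f x # g x # map g xs) = \<psi> (f x # g x # map g xs)"
    by (rule Cons.prems) auto
  ultimately show ?case by simp
qed simp

text \<open>
  The walls between consecutive simplices of the prism cancel; the bottom, the top and the prism over
  the boundary remain.
\<close>

lemma prism_homotopy:
  "prism f g (coboundary \<phi>) xs + coboundary (prism f g \<phi>) xs = \<phi> (map f xs) + \<phi> (map g xs)"
proof (induction xs arbitrary: \<phi>)
  case (Cons x xs)
  define \<phi>' where "\<phi>' = (\<lambda>\<sigma>. \<phi> (f x # \<sigma>))"
  have "prism f g (coboundary \<phi>) (x # xs) =
      \<phi> (g x # map g xs) + \<phi> (f x # map g xs) + coboundary (\<lambda>\<sigma>. \<phi>' (g x # map g \<sigma>)) xs
      + (prism f g \<phi> xs + prism f g (coboundary \<phi>') xs)"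
    by (simp add: prism_add \<phi>'_def coboundary_map ac_simps)
  moreover have "coboundary (prism f g \<phi>) (x # xs) =
      prism f g \<phi> xs + (coboundary (\<lambda>\<sigma>. \<phi>' (g x # map g \<sigma>)) xs + coboundary (prism f g \<phi>') xs)"
    by (simp add: coboundary_add \<phi>'_def)
  ultimately have "prism f g (coboundary \<phi>) (x # xs) + coboundary (prism f g \<phi>) (x # xs) =
      \<phi> (g x # map g xs) + \<phi> (f x # map g xs) +
      (prism f g (coboundary \<phi>') xs + coboundary (prism f g \<phi>') xs)"
    by (simp add: ac_simps)
  also have "\<dots> = \<phi> (map f (x # xs)) + \<phi> (map g (x # xs))"
    unfolding Cons.IH by (simp add: \<phi>'_def ac_simps)
  finally show ?case .
qed simp

text \<open>
  Any two vertex maps are homotopic through the prism operator; what matters is only that the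
  prisms are made of simplices in \<open>T'\<close>, that is, in the application, that the maps are close.
\<close>

lemma bounds_on_prism:
  assumes z: "chain_on T z" and cycle: "\<And>\<phi>. z (coboundary \<phi>) = 0"
    and T': "\<And>\<sigma> \<tau>. \<sigma> \<in> T \<Longrightarrow> set \<tau> \<subseteq> f ` set \<sigma> \<union> g ` set \<sigma> \<Longrightarrow> length \<tau> = Suc (length \<sigma>) \<Longrightarrow> \<tau> \<in> T'"
  shows "bounds_on T' (\<lambda>\<phi>. z (\<lambda>\<sigma>. \<phi> (map f \<sigma>)) + z (\<lambda>\<sigma>. \<phi> (map g \<sigma>)))"
  unfolding bounds_on_def
proof (intro exI conjI allI)
  show "chain_on T' (\<lambda>\<phi>. z (prism f g \<phi>))"
    unfolding chain_on_def
  proof (intro conjI allI impI)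
    fix \<phi> \<psi> :: "'b list \<Rightarrow> bit"
    have "prism f g (\<lambda>\<sigma>. \<phi> \<sigma> + \<psi> \<sigma>) = (\<lambda>\<sigma>. prism f g \<phi> \<sigma> + prism f g \<psi> \<sigma>)"
      by (simp add: fun_eq_iff prism_add)
    then show "z (prism f g (\<lambda>\<sigma>. \<phi> \<sigma> + \<psi> \<sigma>)) = z (prism f g \<phi>) + z (prism f g \<psi>)"
      by (simp add: chain_on_add[OF z])
    assume "\<forall>\<sigma>\<in>T'. \<phi> \<sigma> = \<psi> \<sigma>"
    then show "z (prism f g \<phi>) = z (prism f g \<psi>)"
      by (intro chain_on_cong[OF z] prism_cong) (use T' in blast)
  qed
next
  fix \<phi> :: "'b list \<Rightarrow> bit"
  have "z (prism f g (coboundary \<phi>)) = z (prism f g (coboundary \<phi>)) + z (coboundary (prism f g \<phi>))"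
    by (simp add: cycle)
  also have "\<dots> = z (\<lambda>\<sigma>. \<phi> (map f \<sigma>) + \<phi> (map g \<sigma>))"
    by (simp flip: chain_on_add[OF z] add: prism_homotopy)
  finally show "z (prism f g (coboundary \<phi>)) = z (\<lambda>\<sigma>. \<phi> (map f \<sigma>)) + z (\<lambda>\<sigma>. \<phi> (map g \<sigma>))"
    by (simp add: chain_on_add[OF z])
qed

text \<open>
  Coning off at \<open>p\<close>: the facet opposite to the apex is the image of the cycle, and the other facets
  form the cone over its boundary, which is zero.
\<close>

lemma bounds_on_const:
  assumes z: "chain_on T z" and cycle: "\<And>\<phi>. z (coboundary \<phi>) = 0"
    and T': "\<And>\<sigma>. \<sigma> \<in> T \<Longrightarrow> p # map (\<lambda>_. p) \<sigma> \<in> T'"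
  shows "bounds_on T' (\<lambda>\<phi>. z (\<lambda>\<sigma>. \<phi> (map (\<lambda>_. p) \<sigma>)))"
  unfolding bounds_on_def
proof (intro exI conjI allI)
  show "chain_on T' (\<lambda>\<phi>. z (\<lambda>\<sigma>. \<phi> (p # map (\<lambda>_. p) \<sigma>)))"
    unfolding chain_on_def
    by (auto simp: chain_on_add[OF z] intro!: chain_on_cong[OF z] T')
next
  fix \<phi> :: "'b list \<Rightarrow> bit"
  have "z (\<lambda>\<sigma>. coboundary \<phi> (p # map (\<lambda>_. p) \<sigma>)) =
      z (\<lambda>\<sigma>. \<phi> (map (\<lambda>_. p) \<sigma>)) + z (coboundary (\<lambda>\<sigma>. \<phi> (p # map (\<lambda>_. p) \<sigma>)))"
    by (simp add: chain_on_add[OF z] coboundary_map)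
  then show "z (\<lambda>\<sigma>. coboundary \<phi> (p # map (\<lambda>_. p) \<sigma>)) = z (\<lambda>\<sigma>. \<phi> (map (\<lambda>_. p) \<sigma>))"
    by (simp add: cycle)
qed

text \<open>
  The prisms between consecutive stages connect the cycle to its image in the point \<open>p\<close>: modulo two,
  the intermediate stages cancel in pairs.
\<close>

lemma bounds_on_contraction:
  assumes z: "chain_on T z" and cycle: "\<And>\<phi>. z (coboundary \<phi>) = 0"
    and step: "\<And>j \<sigma> \<tau>. j < N \<Longrightarrow> \<sigma> \<in> T \<Longrightarrow> set \<tau> \<subseteq> h j ` set \<sigma> \<union> h (Suc j) ` set \<sigma> \<Longrightarrow>
      length \<tau> = Suc (length \<sigma>) \<Longrightarrow> \<tau> \<in> T'"
    and start: "\<And>\<sigma>. \<sigma> \<in> T \<Longrightarrow> map (h 0) \<sigma> = \<sigma>"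
    and stop: "\<And>x. h N x = p" and cone: "\<And>\<sigma>. \<sigma> \<in> T \<Longrightarrow> p # map (\<lambda>_. p) \<sigma> \<in> T'"
  shows "bounds_on T' z"
proof -
  have "bounds_on T' (\<lambda>\<phi>. z (\<lambda>\<sigma>. \<phi> (map (h 0) \<sigma>)) + z (\<lambda>\<sigma>. \<phi> (map (h j) \<sigma>)))"
    if "j \<le> N" for j
    using that
  proof (induction j)
    case 0
    have "chain_on T' (\<lambda>_. 0)" by (simp add: chain_on_def)
    then show ?case unfolding bounds_on_def by (intro exI[of _ "\<lambda>_. 0"]) simp
  next
    case (Suc j)
    have "bounds_on T' (\<lambda>\<phi>. z (\<lambda>\<sigma>. \<phi> (map (h j) \<sigma>)) + z (\<lambda>\<sigma>. \<phi> (map (h (Suc j)) \<sigma>)))"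
      using Suc.prems by (intro bounds_on_prism[OF z cycle] step[of j]) auto
    from bounds_on_sum[OF Suc.IH this] Suc.prems show ?case
      by (simp add: ac_simps)
  qed
  from bounds_on_sum[OF this[of N] bounds_on_const[OF z cycle cone]]
  have "bounds_on T' (\<lambda>\<phi>. z (\<lambda>\<sigma>. \<phi> (map (h 0) \<sigma>)))"
    by (simp add: stop[abs_def] ac_simps)
  moreover have "z (\<lambda>\<sigma>. \<phi> (map (h 0) \<sigma>)) = z \<phi>" for \<phi>
    by (rule chain_on_cong[OF z]) (simp add: start)
  ultimately show ?thesis by simp
qed


section \<open>Tucker's lemma on the boundary of the cube\<close>

text \<open>
  The Vietoris-Rips simplices of dimension \<open>k\<close> at scale \<open>\<delta>\<close>. The coordinates beyond \<open>k\<close> are \<open>0\<close>, so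
  comparing all coordinates is the same as comparing in the \<open>\<ell>\<^sup>\<infinity>\<close> norm, and the cube boundaries of
  different dimensions can be compared without naming the dimension.
\<close>

definition small_simplices :: "nat \<Rightarrow> real \<Rightarrow> (nat \<Rightarrow> real) list set" where
  "small_simplices k \<delta> = {\<sigma>. length \<sigma> = Suc k \<and> set \<sigma> \<subseteq> cube_boundary k \<and>
     (\<forall>x\<in>set \<sigma>. \<forall>y\<in>set \<sigma>. \<forall>i. \<bar>x i - y i\<bar> \<le> \<delta>)}"

lemma uminus_uminus_fun: "- (- x) = (x :: 'a \<Rightarrow> real)"
  by (simp add: fun_eq_iff)

lemma uminus_in_cube_boundary: "x \<in> cube_boundary k \<Longrightarrow> - x \<in> cube_boundary k"
  using isometric_involution_cube[of k] by (simp add: isometric_involution_def)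

lemma cube_boundary_mono: "k \<le> n \<Longrightarrow> cube_boundary k \<subseteq> cube_boundary n"
proof
  fix x assume k: "k \<le> n" and x: "x \<in> cube_boundary k"
  have "x i \<in> {-1..1}" for i
    using x by (cases "i \<le> k") (auto simp: cube_boundary_def)
  moreover have "\<exists>i\<le>n. x i = 1 \<or> x i = -1"
    using x k unfolding cube_boundary_def by (blast intro: order_trans)
  ultimately show "x \<in> cube_boundary n"
    using x k by (simp add: cube_boundary_def)
qed

lemma map_uminus_small_simplices:
  "\<sigma> \<in> small_simplices k \<delta> \<Longrightarrow> map uminus \<sigma> \<in> small_simplices k \<delta>"
  by (auto simp: small_simplices_def uminus_in_cube_boundary abs_minus_commute)

text \<open>
  Contracts \<open>cube_boundary k\<close> inside \<open>cube_boundary (Suc k)\<close>. For \<open>0 \<le> t \<le> 1\<close> it slides up the side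
  of the larger cube; for \<open>1 \<le> t \<le> 2\<close> it shrinks to the centre of the top face.
\<close>

definition cap_homotopy :: "nat \<Rightarrow> real \<Rightarrow> (nat \<Rightarrow> real) \<Rightarrow> nat \<Rightarrow> real" where
  "cap_homotopy k t x = (\<lambda>i. if i = Suc k then min 1 t else x i * min 1 (2 - t))"

lemma cap_homotopy_in_cube_boundary:
  assumes x: "x \<in> cube_boundary k" and t: "0 \<le> t" "t \<le> 2"
  shows "cap_homotopy k t x \<in> cube_boundary (Suc k)"
proof -
  have "\<bar>x i * min 1 (2 - t)\<bar> \<le> 1 * 1" if "i \<le> k" for i
    unfolding abs_mult by (rule mult_mono) (use x t that in \<open>auto simp: cube_boundary_def abs_le_iff\<close>)
  then have bound: "\<forall>i\<le>Suc k. cap_homotopy k t x i \<in> {-1..1}"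
    using t by (auto simp: cap_homotopy_def abs_le_iff le_Suc_eq minus_le_iff)
  obtain i where i: "i \<le> k" "x i = 1 \<or> x i = -1"
    using x by (auto simp: cube_boundary_def)
  have "\<exists>i\<le>Suc k. cap_homotopy k t x i = 1 \<or> cap_homotopy k t x i = -1"
  proof (cases "t \<le> 1")
    case True
    then show ?thesis using i by (intro exI[of _ i]) (auto simp: cap_homotopy_def)
  next
    case False
    then show ?thesis by (intro exI[of _ "Suc k"]) (auto simp: cap_homotopy_def)
  qed
  moreover have "\<forall>i>Suc k. cap_homotopy k t x i = 0"
    using x by (auto simp: cap_homotopy_def cube_boundary_def)
  ultimately show ?thesis
    using bound by (simp add: cube_boundary_def)
qed

lemma cap_homotopy_start: "x \<in> cube_boundary k \<Longrightarrow> cap_homotopy k 0 x = x"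
  by (auto simp: cap_homotopy_def cube_boundary_def fun_eq_iff)

lemma cap_homotopy_stop: "cap_homotopy k 2 x = (\<lambda>i. if i = Suc k then 1 else 0)"
  by (auto simp: cap_homotopy_def fun_eq_iff)

lemma cap_homotopy_dist:
  assumes x: "x \<in> cube_boundary k" "y \<in> cube_boundary k"
    and t: "0 \<le> s" "s \<le> 2" "0 \<le> t" "t \<le> 2" and "\<bar>s - t\<bar> \<le> \<eta>" and "\<bar>x i - y i\<bar> \<le> \<delta>" "0 \<le> \<delta>"
  shows "\<bar>cap_homotopy k s x i - cap_homotopy k t y i\<bar> \<le> \<delta> + \<eta>"
proof (cases "i = Suc k")
  case False
  let ?a = "min 1 (2 - s)" and ?b = "min 1 (2 - t)"
  have y: "\<bar>y i\<bar> \<le> 1"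
    using x(2) by (cases "i \<le> k") (auto simp: cube_boundary_def abs_le_iff)
  have "\<bar>x i - y i\<bar> * \<bar>?a\<bar> \<le> \<delta> * 1"
    by (rule mult_mono) (use assms in auto)
  moreover have "\<bar>y i\<bar> * \<bar>?a - ?b\<bar> \<le> 1 * \<eta>"
    by (rule mult_mono) (use y assms(7) in auto)
  moreover have "x i * ?a - y i * ?b = (x i - y i) * ?a + y i * (?a - ?b)"
    by (simp add: algebra_simps)
  then have "\<bar>x i * ?a - y i * ?b\<bar> \<le> \<bar>x i - y i\<bar> * \<bar>?a\<bar> + \<bar>y i\<bar> * \<bar>?a - ?b\<bar>"
    by (metis abs_triangle_ineq abs_mult)
  ultimately show ?thesis
    using False by (simp add: cap_homotopy_def)
qed (use assms in \<open>auto simp: cap_homotopy_def\<close>)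

text \<open>
  The contraction is cut into \<open>2 M\<close> time steps of length at most \<open>\<delta> / 2\<close>. It does not increase distances
  at a fixed time, so a prism over a simplex of diameter \<open>\<delta> / 2\<close> has diameter at most \<open>\<delta>\<close>.
\<close>

lemma bounds_on_next_cube:
  assumes "0 < \<delta>"
    and z: "chain_on (small_simplices k (\<delta> / 2)) z" and cycle: "\<And>\<phi>. z (coboundary \<phi>) = 0"
  shows "bounds_on (small_simplices (Suc k) \<delta>) z"
proof -
  obtain M :: nat where M: "0 < M" "1 / real M \<le> \<delta> / 2"
    using \<open>0 < \<delta>\<close> by (metis half_gt_zero less_imp_le nat_approx_posE zero_less_Suc)
  define h where "h j = cap_homotopy k (real j / real M)" for j
  show ?thesis
  proof (rule bounds_on_contraction[OF z cycle, where N = "2 * M" and h = h])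
    fix j \<sigma> \<tau>
    assume j: "j < 2 * M" and \<sigma>: "\<sigma> \<in> small_simplices k (\<delta> / 2)"
      and \<tau>: "set \<tau> \<subseteq> h j ` set \<sigma> \<union> h (Suc j) ` set \<sigma>" "length \<tau> = Suc (length \<sigma>)"
    define I where "I = {t. \<exists>i \<in> {j, Suc j}. t = real i / real M}"
    have I: "0 \<le> t \<and> t \<le> 2" if "t \<in> I" for t
      using that j M by (auto simp: I_def divide_le_eq)
    have I_dist: "\<bar>s - t\<bar> \<le> \<delta> / 2" if "s \<in> I" "t \<in> I" for s t
    proof -
      have "\<bar>s - t\<bar> \<le> 1 / real M"
        using that M(1) by (auto simp: I_def simp flip: diff_divide_distrib)
      then show ?thesis using M(2) by linarith
    qed
    have \<tau>_form: "\<exists>t\<in>I. \<exists>x\<in>set \<sigma>. u = cap_homotopy k t x" if "u \<in> set \<tau>" for u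
      using that \<tau>(1) unfolding I_def h_def by blast
    have \<sigma>_sub: "x \<in> cube_boundary k" if "x \<in> set \<sigma>" for x
      using that \<sigma> by (auto simp: small_simplices_def)
    have \<sigma>_dist: "\<bar>x i - y i\<bar> \<le> \<delta> / 2" if "x \<in> set \<sigma>" "y \<in> set \<sigma>" for x y i
      using that \<sigma> by (auto simp: small_simplices_def)
    show "\<tau> \<in> small_simplices (Suc k) \<delta>"
      unfolding small_simplices_def
    proof (intro CollectI conjI ballI allI subsetI)
      show "length \<tau> = Suc (Suc k)"
        using \<tau>(2) \<sigma> by (simp add: small_simplices_def)
    next
      fix u assume "u \<in> set \<tau>"
      then show "u \<in> cube_boundary (Suc k)"
        using \<tau>_form I \<sigma>_sub cap_homotopy_in_cube_boundary by blast
    next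
      fix u v i assume "u \<in> set \<tau>" "v \<in> set \<tau>"
      then obtain s t x y where st: "s \<in> I" "t \<in> I" and xy: "x \<in> set \<sigma>" "y \<in> set \<sigma>"
        and uv: "u = cap_homotopy k s x" "v = cap_homotopy k t y"
        using \<tau>_form by meson
      have "\<bar>u i - v i\<bar> \<le> \<delta> / 2 + \<delta> / 2"
        unfolding uv by (rule cap_homotopy_dist) (use st xy I I_dist \<sigma>_sub \<sigma>_dist \<open>0 < \<delta>\<close> in auto)
      then show "\<bar>u i - v i\<bar> \<le> \<delta>" by simp
    qed
  next
    fix \<sigma> assume "\<sigma> \<in> small_simplices k (\<delta> / 2)"
    then show "map (h 0) \<sigma> = \<sigma>"
      by (intro map_idI) (auto simp: h_def small_simplices_def cap_homotopy_start)
  next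
    fix x
    have "real (2 * M) / real M = 2" using M by simp
    then show "h (2 * M) x = (\<lambda>i. if i = Suc k then 1 else 0)"
      by (simp add: h_def cap_homotopy_stop del: of_nat_mult)
  next
    fix \<sigma> assume "\<sigma> \<in> small_simplices k (\<delta> / 2)"
    moreover have "(\<lambda>i. if i = Suc k then 1 else 0) \<in> cube_boundary (Suc k)"
      by (auto simp: cube_boundary_def)
    ultimately show "(\<lambda>i. if i = Suc k then 1 else 0) # map (\<lambda>_ i. if i = Suc k then 1 else 0) \<sigma>
        \<in> small_simplices (Suc k) \<delta>"
      using \<open>0 < \<delta>\<close> by (auto simp: small_simplices_def)
  qed
qed

definition Tucker_labelling :: "nat \<Rightarrow> real \<Rightarrow> ((nat \<Rightarrow> real) \<Rightarrow> int) \<Rightarrow> bool" where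
  "Tucker_labelling k \<delta> lab \<longleftrightarrow>
     (\<forall>x\<in>cube_boundary k. lab x \<noteq> 0 \<and> lab (- x) = - lab x) \<and>
     (\<forall>x\<in>cube_boundary k. \<forall>y\<in>cube_boundary k. (\<forall>i. \<bar>x i - y i\<bar> \<le> \<delta>) \<longrightarrow> lab x \<noteq> - lab y)"

lemma Tucker_labelling_mono:
  assumes "Tucker_labelling n \<delta> lab" "k \<le> n" "\<delta>' \<le> \<delta>"
  shows "Tucker_labelling k \<delta>' lab"
  using assms(1,3) cube_boundary_mono[OF assms(2)] unfolding Tucker_labelling_def
  by (meson order_trans subsetD)

lemma fan_labels_uminus:
  assumes "Tucker_labelling k \<delta> lab" "\<sigma> \<in> small_simplices k \<delta>"
  shows "fan p (map lab (map uminus \<sigma>)) = fan (\<not> p) (map lab \<sigma>)"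
proof -
  have sub: "set \<sigma> \<subseteq> cube_boundary k"
    using assms(2) by (simp add: small_simplices_def)
  then have "fan p (map lab (map uminus \<sigma>)) = fan p (map uminus (map lab \<sigma>))"
    using assms(1) by (intro arg_cong[where f = "fan p"]) (auto simp: Tucker_labelling_def)
  moreover have "0 \<notin> set (map lab \<sigma>)"
    using assms(1) sub by (force simp: Tucker_labelling_def)
  ultimately show ?thesis by (simp only: fan_uminus not_False_eq_True)
qed

lemma coboundary_fan_labels:
  assumes "Tucker_labelling k \<delta> lab" "\<sigma> \<in> small_simplices k \<delta>"
  shows "coboundary (\<lambda>\<sigma>. fan p (map lab \<sigma>)) \<sigma> = fan True (map lab \<sigma>) + fan False (map lab \<sigma>)"
proof -
  have "lab x \<noteq> - lab y" if "x \<in> set \<sigma>" "y \<in> set \<sigma>" for x y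
    using that assms unfolding Tucker_labelling_def small_simplices_def by blast
  then have "inj_on abs (set (map lab \<sigma>))"
    by (auto simp: inj_on_def abs_eq_iff)
  then show ?thesis
    by (simp add: coboundary_fan flip: coboundary_map)
qed

text \<open>
  The scale is halved in each step down, because filling a cycle doubles it.
\<close>

lemma Fan_cycle:
  assumes "0 < \<delta>" "Tucker_labelling k \<delta> lab"
  shows "\<exists>z. chain_on (small_simplices k \<delta>) z \<and> (\<forall>\<phi>. z (coboundary \<phi>) = 0) \<and>
    (\<forall>\<phi>. z (\<lambda>\<sigma>. \<phi> (map uminus \<sigma>)) = z \<phi>) \<and> z (\<lambda>\<sigma>. fan True (map lab \<sigma>)) = 1"
  using assms
proof (induction k arbitrary: \<delta>)
  case 0
  define v :: "nat \<Rightarrow> real" where "v = (\<lambda>i. if i = 0 then 1 else 0)"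
  have v: "v \<in> cube_boundary 0" and v': "- v \<in> cube_boundary 0"
    by (auto simp: cube_boundary_def v_def)
  have lab: "lab v \<noteq> 0" "lab (- v) = - lab v"
    using 0 v by (auto simp: Tucker_labelling_def)
  have "chain_on (small_simplices 0 \<delta>) (\<lambda>\<phi>. \<phi> [v] + \<phi> [- v])"
    using v v' \<open>0 < \<delta>\<close> by (simp add: chain_on_def small_simplices_def ac_simps)
  moreover have "fan True [lab v] + fan True [lab (- v)] = 1"
    using lab by (cases "0 < lab v") (auto simp: fan_def)
  ultimately show ?case
    by (intro exI[of _ "\<lambda>\<phi>. \<phi> [v] + \<phi> [- v]"]) (simp add: fun_Compl_def ac_simps)
next
  case (Suc k)
  let ?T = "small_simplices (Suc k) \<delta>"
  let ?fan = "\<lambda>p \<sigma>. fan p (map lab \<sigma>)"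
  have "Tucker_labelling k (\<delta> / 2) lab"
    using Suc.prems by (intro Tucker_labelling_mono[OF Suc.prems(2)]) auto
  with Suc.IH[of "\<delta> / 2"] \<open>0 < \<delta>\<close> obtain z where
    z: "chain_on (small_simplices k (\<delta> / 2)) z" "\<And>\<phi>. z (coboundary \<phi>) = 0"
      "\<And>\<phi>. z (\<lambda>\<sigma>. \<phi> (map uminus \<sigma>)) = z \<phi>" "z (?fan True) = 1"
    by (meson half_gt_zero)
  obtain c where c: "chain_on ?T c" and cz: "\<And>\<phi>. c (coboundary \<phi>) = z \<phi>"
    using bounds_on_next_cube[OF \<open>0 < \<delta>\<close> z(1,2)] unfolding bounds_on_def by auto
  \<comment> \<open>The next sphere is the union of the hemisphere \<open>c\<close> and its antipode.\<close>
  define w where "w \<phi> = c \<phi> + c (\<lambda>\<sigma>. \<phi> (map uminus \<sigma>))" for \<phi>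
  have "chain_on ?T w"
    unfolding w_def
    by (rule chain_on_sum[OF c chain_on_pushforward[OF c map_uminus_small_simplices]])
  moreover have "w (coboundary \<phi>) = 0" for \<phi>
    by (simp add: w_def coboundary_map cz z(3))
  moreover have "w (\<lambda>\<sigma>. \<phi> (map uminus \<sigma>)) = w \<phi>" for \<phi>
    by (simp add: w_def comp_def uminus_uminus_fun add.commute)
  moreover have "w (?fan True) = 1"
  proof -
    have "w (?fan True) = c (\<lambda>\<sigma>. ?fan True \<sigma> + ?fan True (map uminus \<sigma>))"
      by (simp add: w_def chain_on_add[OF c])
    also have "\<dots> = c (coboundary (?fan True))"
      by (rule chain_on_cong[OF c])
        (simp only: fan_labels_uminus[OF Suc.prems(2)] coboundary_fan_labels[OF Suc.prems(2)]
          not_True_eq_False)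
    finally show ?thesis by (simp add: cz z(4))
  qed
  ultimately show ?case by blast
qed

theorem Tucker_cube:
  assumes "0 < \<delta>"
    and nz: "\<And>x. x \<in> cube_boundary n \<Longrightarrow> lab x \<noteq> 0 \<and> \<bar>lab x\<bar> \<le> int n"
    and odd: "\<And>x. x \<in> cube_boundary n \<Longrightarrow> lab (- x) = - lab x"
  obtains x y where "x \<in> cube_boundary n" "y \<in> cube_boundary n"
    "\<And>i. \<bar>x i - y i\<bar> \<le> \<delta>" "lab x = - lab y"
proof (rule ccontr)
  assume "\<not> thesis"
  then have "Tucker_labelling n \<delta> lab"
    using nz odd that unfolding Tucker_labelling_def by blast
  then obtain z where z: "chain_on (small_simplices n \<delta>) z" "z (\<lambda>\<sigma>. fan True (map lab \<sigma>)) = 1"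
    using Fan_cycle[OF \<open>0 < \<delta>\<close>] by blast
  have "z (\<lambda>\<sigma>. fan True (map lab \<sigma>)) = z (\<lambda>\<sigma>. 0)"
  proof (rule chain_on_cong[OF z(1)])
    fix \<sigma> assume "\<sigma> \<in> small_simplices n \<delta>"
    then show "fan True (map lab \<sigma>) = 0"
      using nz by (intro fan_eq_0[where n = n]) (auto simp: small_simplices_def)
  qed
  moreover have "z (\<lambda>\<sigma>. 0) = 0"
    using chain_on_add[OF z(1), of "\<lambda>_. 0" "\<lambda>_. 0"] by simp
  ultimately show False using z(2) by simp
qed

section \<open>Correspondences between cube boundaries\<close>

text \<open>
  A point may lie on several faces. The least index is chosen, rather than an arbitrary one, because it
  is the same for \<open>x\<close> and \<open>- x\<close>, which makes the label odd.
\<close>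

definition face_label :: "nat \<Rightarrow> (nat \<Rightarrow> real) \<Rightarrow> int" where
  "face_label m x = (let i = LEAST i. i \<le> m \<and> \<bar>x i\<bar> = 1 in (if 0 < x i then 1 else -1) * int (Suc i))"

lemma face_labelE:
  assumes "x \<in> cube_boundary m"
  obtains i where "i \<le> m" "\<bar>x i\<bar> = 1" "face_label m x = (if 0 < x i then 1 else -1) * int (Suc i)"
proof -
  have "\<exists>i. i \<le> m \<and> \<bar>x i\<bar> = 1"
    using assms by (auto simp: cube_boundary_def)
  from LeastI_ex[OF this] show ?thesis
    by (intro that[of "LEAST i. i \<le> m \<and> \<bar>x i\<bar> = 1"]) (simp_all only: face_label_def Let_def)
qed

lemma face_label_uminus:
  assumes "x \<in> cube_boundary m"
  shows "face_label m (- x) = - face_label m x"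
proof -
  let ?i = "LEAST i. i \<le> m \<and> \<bar>x i\<bar> = 1"
  have "\<exists>i. i \<le> m \<and> \<bar>x i\<bar> = 1"
    using assms by (auto simp: cube_boundary_def)
  from LeastI_ex[OF this] have "\<bar>x ?i\<bar> = 1" by simp
  then show ?thesis by (auto simp: face_label_def Let_def)
qed

lemma opposite_faces_far:
  assumes x: "x \<in> cube_boundary m" and y: "y \<in> cube_boundary m"
    and eq: "face_label m x = - face_label m y"
  shows "2 \<le> linf_norm m (x - y)"
proof -
  obtain i where i: "i \<le> m" "\<bar>x i\<bar> = 1" "face_label m x = (if 0 < x i then 1 else -1) * int (Suc i)"
    using face_labelE[OF x] .
  obtain j where j: "j \<le> m" "\<bar>y j\<bar> = 1" "face_label m y = (if 0 < y j then 1 else -1) * int (Suc j)"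
    using face_labelE[OF y] .
  have "i = j" "(0 < x i) \<noteq> (0 < y j)"
    using eq i(3) j(3) by (auto split: if_splits)
  then have "\<bar>(x - y) i\<bar> = 2"
    using i(2) j(2) by auto
  then show ?thesis
    using abs_le_linf_norm[OF i(1), of "x - y"] by simp
qed

text \<open>
  The involution \<open>u \<mapsto> - u\<close> has no fixed point on \<open>cube_boundary n\<close>, so a partner can be chosen
  for one point of each antipodal pair and transported to the other one. The sign of the first nonzero
  coordinate decides which of the two points is chosen.
\<close>

lemma odd_selection:
  assumes R: "Z2_correspondence X \<tau> (cube_inf n) uminus R"
    and \<tau>: "\<And>x. x \<in> mspace X \<Longrightarrow> \<tau> (\<tau> x) = x"
  obtains f where "\<And>y. y \<in> cube_boundary n \<Longrightarrow> (f y, y) \<in> R"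
    "\<And>y. y \<in> cube_boundary n \<Longrightarrow> f (- y) = \<tau> (f y)"
proof -
  have sub: "R \<subseteq> mspace X \<times> cube_boundary n"
    and onto: "snd ` R = cube_boundary n"
    and sym: "\<And>x y. (x, y) \<in> R \<Longrightarrow> (\<tau> x, - y) \<in> R"
    using R by (simp_all add: Z2_correspondence_def)
  have "\<exists>x. (x, y) \<in> R" if "y \<in> cube_boundary n" for y
    using that onto by force
  then obtain g where g: "\<And>y. y \<in> cube_boundary n \<Longrightarrow> (g y, y) \<in> R"
    by metis
  define pos where "pos y \<longleftrightarrow> 0 < y (LEAST i. y i \<noteq> 0)" for y :: "nat \<Rightarrow> real"
  have pos: "pos (- y) \<longleftrightarrow> \<not> pos y" if y: "y \<in> cube_boundary n" for y
  proof -
    obtain i where "y i = 1 \<or> y i = -1"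
      using y unfolding cube_boundary_def by blast
    then have "\<exists>i. y i \<noteq> 0"
      by (intro exI[of _ i]) auto
    then have "y (LEAST i. y i \<noteq> 0) \<noteq> 0" by (rule LeastI_ex)
    then show ?thesis by (auto simp: pos_def)
  qed
  define f where "f y = (if pos y then g y else \<tau> (g (- y)))" for y
  show ?thesis
  proof
    fix y assume y: "y \<in> cube_boundary n"
    have g': "(g (- y), - y) \<in> R"
      using g uminus_in_cube_boundary[OF y] by blast
    show "(f y, y) \<in> R"
      using g[OF y] sym[OF g'] by (simp add: f_def uminus_uminus_fun)
    have "g (- y) \<in> mspace X" using g' sub by auto
    then show "f (- y) = \<tau> (f y)"
      by (simp add: f_def pos[OF y] \<tau> uminus_uminus_fun)
  qed
qed

text \<open>
  As \<open>m + 1 \<le> n\<close>, the faces of the smaller cube provide few enough labels for Tucker's lemma on the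
  larger one.
\<close>

lemma distortion_lower_bound:
  assumes "m < n" and R: "Z2_correspondence (cube_inf m) uminus (cube_inf n) uminus R" and "0 < \<delta>"
  shows "ennreal (2 - \<delta>) \<le> distortion (cube_inf m) (cube_inf n) R"
proof -
  have sub: "R \<subseteq> cube_boundary m \<times> cube_boundary n"
    using R by (simp add: Z2_correspondence_def)
  obtain f where f: "\<And>y. y \<in> cube_boundary n \<Longrightarrow> (f y, y) \<in> R"
    and f_odd: "\<And>y. y \<in> cube_boundary n \<Longrightarrow> f (- y) = - f y"
    by (rule odd_selection[OF R uminus_uminus_fun]) blast
  have f_in: "f y \<in> cube_boundary m" if "y \<in> cube_boundary n" for y
    using f[OF that] sub by auto
  define lab where "lab y = face_label m (f y)" for y
  have lab_range: "lab y \<noteq> 0 \<and> \<bar>lab y\<bar> \<le> int n" if y: "y \<in> cube_boundary n" for y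
  proof -
    obtain i where "i \<le> m"
      "face_label m (f y) = (if 0 < f y i then 1 else -1) * int (Suc i)"
      by (rule face_labelE[OF f_in[OF y]])
    with \<open>m < n\<close> show ?thesis
      by (simp add: lab_def)
  qed
  have lab_odd: "lab (- y) = - lab y" if "y \<in> cube_boundary n" for y
    using that by (simp add: lab_def f_odd face_label_uminus f_in)
  obtain x y where xy: "x \<in> cube_boundary n" "y \<in> cube_boundary n"
    and near: "\<And>i. \<bar>x i - y i\<bar> \<le> \<delta>" and opp: "lab x = - lab y"
    using Tucker_cube[of \<delta> n lab, OF \<open>0 < \<delta>\<close> lab_range lab_odd] by blast
  have "linf_norm n (x - y) \<le> \<delta>"
    using near by (simp add: linf_norm_le_iff)
  moreover have "2 \<le> linf_norm m (f x - f y)"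
    using opp unfolding lab_def by (rule opposite_faces_far[OF f_in[OF xy(1)] f_in[OF xy(2)]])
  ultimately have "2 - \<delta> \<le> \<bar>linf_norm m (f x - f y) - linf_norm n (x - y)\<bar>"
    by linarith
  then have "ennreal (2 - \<delta>) \<le> ennreal \<bar>linf_norm m (f x - f y) - linf_norm n (x - y)\<bar>"
    by (rule ennreal_leI)
  also have "\<dots> \<le> distortion (cube_inf m) (cube_inf n) R"
    unfolding distortion_def
    using f[OF xy(1)] f[OF xy(2)] by (intro SUP_upper2[where i = "((f x, x), (f y, y))"]) simp_all
  finally show ?thesis .
qed

lemma linf_norm_diff_le_2:
  assumes "x \<in> cube_boundary n" "y \<in> cube_boundary n"
  shows "linf_norm n (x - y) \<le> 2"
  unfolding linf_norm_le_iff
proof (intro allI impI)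
  fix i assume "i \<le> n"
  then have "x i \<in> {-1..1}" "y i \<in> {-1..1}"
    using assms by (auto simp: cube_boundary_def)
  then show "\<bar>(x - y) i\<bar> \<le> 2" by auto
qed

lemma distortion_le_2:
  assumes "R \<subseteq> cube_boundary m \<times> cube_boundary n"
  shows "distortion (cube_inf m) (cube_inf n) R \<le> 2"
  unfolding distortion_def
proof (rule SUP_least, clarify)
  fix x y x' y' assume "(x, y) \<in> R" "(x', y') \<in> R"
  then have "x \<in> cube_boundary m" "x' \<in> cube_boundary m" "y \<in> cube_boundary n" "y' \<in> cube_boundary n"
    using assms by auto
  then have "\<bar>linf_norm m (x - x') - linf_norm n (y - y')\<bar> \<le> 2"
    using linf_norm_diff_le_2[of x m x'] linf_norm_diff_le_2[of y n y']
      linf_norm_nonneg[of m "x - x'"] linf_norm_nonneg[of n "y - y'"] by (simp add: abs_le_iff)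
  from ennreal_leI[OF this]
  show "ennreal \<bar>mdist (cube_inf m) x x' - mdist (cube_inf n) y y'\<bar> \<le> 2" by simp
qed

lemma Z2_correspondence_Times:
  "Z2_correspondence (cube_inf m) uminus (cube_inf n) uminus (cube_boundary m \<times> cube_boundary n)"
proof -
  have "(\<lambda>i. if i = 0 then 1 else 0) \<in> cube_boundary k" for k
    by (auto simp: cube_boundary_def)
  then have "cube_boundary k \<noteq> {}" for k by blast
  then show ?thesis
    by (auto simp: Z2_correspondence_def uminus_in_cube_boundary)
qed

theorem theorem11:
  fixes m n :: nat
  assumes "m < n"
  shows "dGH_Z2 (cube_inf m) uminus (cube_inf n) uminus = 1"
proof -
  let ?D = "INF R \<in> {R. Z2_correspondence (cube_inf m) uminus (cube_inf n) uminus R}.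
    distortion (cube_inf m) (cube_inf n) R"
  have "?D \<le> distortion (cube_inf m) (cube_inf n) (cube_boundary m \<times> cube_boundary n)"
    by (rule INF_lower) (simp add: Z2_correspondence_Times)
  also have "\<dots> \<le> 2"
    by (rule distortion_le_2) simp
  finally have upper: "?D \<le> 2" .
  have "2 \<le> ?D"
  proof (rule INF_greatest)
    fix R assume "R \<in> {R. Z2_correspondence (cube_inf m) uminus (cube_inf n) uminus R}"
    then have R: "Z2_correspondence (cube_inf m) uminus (cube_inf n) uminus R" by simp
    show "2 \<le> distortion (cube_inf m) (cube_inf n) R"
    proof (rule ennreal_le_epsilon)
      fix \<delta> :: real assume "0 < \<delta>"
      have "2 \<le> ennreal (2 - \<delta>) + ennreal \<delta>"
      proof (cases "\<delta> \<le> 2")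
        case True
        then show ?thesis
          using \<open>0 < \<delta>\<close> ennreal_plus[of "2 - \<delta>" \<delta>] by simp
      next
        case False
        then show ?thesis
          using ennreal_leI[of 2 \<delta>] by (simp add: ennreal_neg)
      qed
      also have "\<dots> \<le> distortion (cube_inf m) (cube_inf n) R + ennreal \<delta>"
        using distortion_lower_bound[OF assms R \<open>0 < \<delta>\<close>] by (rule add_right_mono)
      finally show "2 \<le> distortion (cube_inf m) (cube_inf n) R + ennreal \<delta>" .
    qed
  qed
  with upper have "?D = 2" by (rule antisym)
  then show ?thesis
    by (simp add: dGH_Z2_def)
qed

end
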